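(* Let $d\ge 2$, let $\Theta\subset\mathbb{R}^m$ be open, and let $\{C_{\theta}:\theta\in\Theta\}$ be a parametric model of $d$-variate copulas (differentiable in $\theta$) that is power-bounded, i.e. for every $\theta\in\Theta$ and every $a>0$, $$\sup_{u\in[0,1]^d}\bigl\| C_{\theta}(u)^{a}\,\nabla_{\theta}\log C_{\theta}(u)\bigr\|<\infty .$$ Let $\hat C$ be the empirical copula of a given sample of size $n$ with pseudo-observations $U_1,\dots,U_n$, and for $u\in[0,1]^d$ and $\theta\in\Theta$ define the estimating functions $$S_\alpha(u,\theta)=\frac{1}{1-\alpha}\,C_{\theta}(u)^{\alpha}\bigl\{C_{\theta}(u)^{1-\alpha}-\hat C(u)^{1-\alpha}\bigr\}\nabla_{\theta}\log C_{\theta}(u),$$ $$S_\beta(u,\theta)=C_{\theta}(u)^{\beta}\bigl\{C_{\theta}(u)-\hat C(u)\bigr\}\nabla_{\theta}\log C_{\theta}(u),$$ $$S_\gamma(u,\theta)=C_{\theta}(u)^{\gamma}\bigl\{\hat w_{\gamma,\theta}\,C_{\theta}(u)-\hat C(u)\bigr\}\nabla_{\theta}\log C_{\theta}(u),\qquad \hat w_{\gamma,\theta}=\frac{\sum_{i=1}^n\hat C(U_i)\,C_{\theta}(U_i)^{\gamma}}{\sum_{i=1}^n C_{\theta}(U_i)^{\gamma+1}} .$$ Then, for each $\theta\in\Theta$: (i) $u\mapsto S_\alpha(u,\theta)$ is uniformly bounded on $[0,1]^d$ if $0<\alpha<1$; (ii) $u\mapsto S_\beta(u,\theta)$ is uniformly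 bounded on $[0,1]^d$ if $\beta>0$; (iii) $u\mapsto S_\gamma(u,\theta)$ is uniformly bounded on $[0,1]^d$ if $\gamma>0$.
   Context: $\nabla_\theta$ is the gradient in $\theta$ and $\|\cdot\|$ the Euclidean norm on $\mathbb{R}^m$. Given a sample $X_1,\dots,X_n\in\mathbb{R}^d$, the pseudo-observations are $$U_i=\frac{1}{n+1}\Bigl(\sum_{j=1}^n \mathbb{I}(X_{j1}\le X_{i1}),\dots,\sum_{j=1}^n \mathbb{I}(X_{jd}\le X_{id})\Bigr),\quad i=1,\dots,n,$$ and the empirical copula is $\hat C(u)=\frac{1}{n+1}\sum_{i=1}^n\prod_{j=1}^d\mathbb{I}(U_{ij}\le u_j)$ for $u\in[0,1]^d$, with $\mathbb{I}$ the indicator function. The sample is fixed; boundedness is in $u$. Expressions containing $\log C_\theta(u)$ are considered at points $u$ where $C_\theta(u)>0$, and in (iii) the denominator of $\hat w_{\gamma,\theta}$ is assumed nonzero so that $\hat w_{\gamma,\theta}$ is defined. *)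

theory Defs
  imports "HOL-Probability.Probability"
begin

definition gradient :: "('a::real_inner \<Rightarrow> real) \<Rightarrow> 'a \<Rightarrow> 'a" where
  "gradient f x = (THE D. GDERIV f x :> D)"

lemma gradient_eqI:
  assumes "GDERIV f x :> D"
  shows "gradient f x = D"
  unfolding gradient_def
proof (rule the_equality[where P = "\<lambda>D. GDERIV f x :> D", OF assms])
  fix E assume "GDERIV f x :> E"
  with assms have "(\<lambda>h. inner h D) = (\<lambda>h. inner h E)"
    unfolding gderiv_def by (rule has_derivative_unique)
  then have "inner (E - D) D = inner (E - D) E" by (rule fun_cong)
  then have "inner (E - D) (E - D) = 0" by (simp add: inner_diff_right)
  then show "E = D" by simp
qed

definition unit_cube :: "(real ^ 'd) set" where
  "unit_cube = {u. \<forall>k. 0 \<le> u $ k \<and> u $ k \<le> 1}"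

(* A copula is the restriction to the unit cube of the distribution function of a random
   vector whose margins are uniform on [0,1]; values outside the cube are irrelevant. *)
definition copula :: "(real ^ 'd \<Rightarrow> real) \<Rightarrow> bool" where
  "copula C \<longleftrightarrow>
    (\<exists>M :: (real ^ 'd) measure.
       prob_space M \<and> sets M = sets borel \<and>
       (\<forall>k. distr M borel (\<lambda>x. x $ k) = uniform_measure lborel {0..1}) \<and>
       (\<forall>u \<in> unit_cube. C u = measure M {x. \<forall>k. x $ k \<le> u $ k}))"

definition copula_model :: "(real ^ 'm) set \<Rightarrow> (real ^ 'm \<Rightarrow> real ^ 'd \<Rightarrow> real) \<Rightarrow> bool" where
  "copula_model \<Theta> C \<longleftrightarrow>
    (\<forall>\<theta> \<in> \<Theta>. copula (C \<theta>)) \<and>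
    (\<forall>\<theta> \<in> \<Theta>. \<forall>u \<in> unit_cube. (\<lambda>t. C t u) differentiable (at \<theta>))"

definition score :: "(real ^ 'm \<Rightarrow> real ^ 'd \<Rightarrow> real) \<Rightarrow> real ^ 'd \<Rightarrow> real ^ 'm \<Rightarrow> real ^ 'm" where
  "score C u \<theta> = gradient (\<lambda>t. ln (C t u)) \<theta>"

(* Where the copula vanishes its logarithm is undefined, so such points are excluded. *)
definition positive_region :: "(real ^ 'd \<Rightarrow> real) \<Rightarrow> (real ^ 'd) set" where
  "positive_region C = {u \<in> unit_cube. C u > 0}"

definition power_bounded :: "(real ^ 'm) set \<Rightarrow> (real ^ 'm \<Rightarrow> real ^ 'd \<Rightarrow> real) \<Rightarrow> bool" where
  "power_bounded \<Theta> C \<longleftrightarrow>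
    (\<forall>\<theta> \<in> \<Theta>. \<forall>a > 0.
       bdd_above ((\<lambda>u. norm ((C \<theta> u powr a) *\<^sub>R score C u \<theta>)) ` positive_region (C \<theta>)))"

(* The sample is X 1, ..., X n; other values of X are ignored. *)
definition pseudo_obs :: "nat \<Rightarrow> (nat \<Rightarrow> real ^ 'd) \<Rightarrow> nat \<Rightarrow> real ^ 'd" where
  "pseudo_obs n X i = (\<chi> k. 1 / (real n + 1) * (\<Sum>j = 1..n. of_bool (X j $ k \<le> X i $ k)))"

definition empirical_copula :: "nat \<Rightarrow> (nat \<Rightarrow> real ^ 'd) \<Rightarrow> real ^ 'd \<Rightarrow> real" where
  "empirical_copula n X u =
    1 / (real n + 1) * (\<Sum>i = 1..n. \<Prod>k \<in> UNIV. of_bool (pseudo_obs n X i $ k \<le> u $ k))"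

definition S_alpha ::
  "(real ^ 'm \<Rightarrow> real ^ 'd \<Rightarrow> real) \<Rightarrow> nat \<Rightarrow> (nat \<Rightarrow> real ^ 'd) \<Rightarrow> real \<Rightarrow> real ^ 'd \<Rightarrow> real ^ 'm \<Rightarrow> real ^ 'm"
  where
  "S_alpha C n X \<alpha> u \<theta> =
    (1 / (1 - \<alpha>) * C \<theta> u powr \<alpha> *
      (C \<theta> u powr (1 - \<alpha>) - empirical_copula n X u powr (1 - \<alpha>))) *\<^sub>R score C u \<theta>"

definition S_beta ::
  "(real ^ 'm \<Rightarrow> real ^ 'd \<Rightarrow> real) \<Rightarrow> nat \<Rightarrow> (nat \<Rightarrow> real ^ 'd) \<Rightarrow> real \<Rightarrow> real ^ 'd \<Rightarrow> real ^ 'm \<Rightarrow> real ^ 'm"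
  where
  "S_beta C n X \<beta> u \<theta> =
    (C \<theta> u powr \<beta> * (C \<theta> u - empirical_copula n X u)) *\<^sub>R score C u \<theta>"

definition w_denom ::
  "(real ^ 'm \<Rightarrow> real ^ 'd \<Rightarrow> real) \<Rightarrow> nat \<Rightarrow> (nat \<Rightarrow> real ^ 'd) \<Rightarrow> real \<Rightarrow> real ^ 'm \<Rightarrow> real" where
  "w_denom C n X \<gamma> \<theta> = (\<Sum>i = 1..n. C \<theta> (pseudo_obs n X i) powr (\<gamma> + 1))"

definition w_hat ::
  "(real ^ 'm \<Rightarrow> real ^ 'd \<Rightarrow> real) \<Rightarrow> nat \<Rightarrow> (nat \<Rightarrow> real ^ 'd) \<Rightarrow> real \<Rightarrow> real ^ 'm \<Rightarrow> real" where
  "w_hat C n X \<gamma> \<theta> =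
    (\<Sum>i = 1..n. empirical_copula n X (pseudo_obs n X i) * C \<theta> (pseudo_obs n X i) powr \<gamma>) /
    w_denom C n X \<gamma> \<theta>"

definition S_gamma ::
  "(real ^ 'm \<Rightarrow> real ^ 'd \<Rightarrow> real) \<Rightarrow> nat \<Rightarrow> (nat \<Rightarrow> real ^ 'd) \<Rightarrow> real \<Rightarrow> real ^ 'd \<Rightarrow> real ^ 'm \<Rightarrow> real ^ 'm"
  where
  "S_gamma C n X \<gamma> u \<theta> =
    (C \<theta> u powr \<gamma> * (w_hat C n X \<gamma> \<theta> * C \<theta> u - empirical_copula n X u)) *\<^sub>R score C u \<theta>"

end

theory Submission
  imports Defs
begin

text \<open>Each estimating function is a product of \<open>C \<theta> u powr a\<close>, a scalar
  weight g(u) and the score, with a equal to \<alpha>, \<beta> or \<gamma>. Power-boundedness at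
  this a > 0 controls the first and last factors together, so only g has to be bounded in u. That
  holds because a copula value is a probability and the empirical copula an average of indicators,
  so both lie in [0,1]; \<open>w_hat\<close> does not depend on u and acts as a constant.
  \<open>power_bounded_imp_bounded\<close> carries the argument, and the three cases only supply a
  bound for g.\<close>

lemma copula_le_1:
  assumes "copula C" and "u \<in> unit_cube"
  shows "C u \<le> 1"
  using assms unfolding copula_def by (metis prob_space.prob_le_1)

lemma empirical_copula_nonneg: "0 \<le> empirical_copula n X u"
  unfolding empirical_copula_def
  by (intro mult_nonneg_nonneg sum_nonneg prod_nonneg) auto

lemma empirical_copula_le_1: "empirical_copula n X u \<le> 1"
proof -
  have "(\<Sum>i = 1..n. \<Prod>k \<in> UNIV. of_bool (pseudo_obs n X i $ k \<le> u $ k)) \<le> (\<Sum>i = 1..n. 1 :: real)"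
    by (intro sum_mono prod_le_1) auto
  then show ?thesis
    unfolding empirical_copula_def by (simp add: field_simps)
qed

text \<open>The scalar weight comes out of the norm as an absolute value, and what remains is
  exactly the quantity that power-boundedness bounds.\<close>

lemma power_bounded_imp_bounded:
  assumes "power_bounded \<Theta> C" and "\<theta> \<in> \<Theta>" and "a > 0"
    and g: "\<And>u. u \<in> positive_region (C \<theta>) \<Longrightarrow> \<bar>g u\<bar> \<le> K"
  shows "bounded ((\<lambda>u. (C \<theta> u powr a * g u) *\<^sub>R score C u \<theta>) ` positive_region (C \<theta>))"
proof -
  obtain B where B: "\<And>u. u \<in> positive_region (C \<theta>) \<Longrightarrow> norm ((C \<theta> u powr a) *\<^sub>R score C u \<theta>) \<le> B"
    using assms(1-3) unfolding power_bounded_def bdd_above_def by fastforce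
  show ?thesis
  proof (rule boundedI, clarify)
    fix u assume u: "u \<in> positive_region (C \<theta>)"
    have "norm ((C \<theta> u powr a * g u) *\<^sub>R score C u \<theta>)
        = \<bar>g u\<bar> * norm ((C \<theta> u powr a) *\<^sub>R score C u \<theta>)"
      by (simp add: abs_mult)
    also have "\<dots> \<le> K * B"
      \<comment> \<open>Monotonicity of the product needs \<open>K\<close> nonnegative, which
        follows from the bound on \<open>g\<close> at this very \<open>u\<close>.\<close>
      using g[OF u] B[OF u] by (intro mult_mono) auto
    finally show "norm ((C \<theta> u powr a * g u) *\<^sub>R score C u \<theta>) \<le> K * B" .
  qed
qed

theorem proposition2:
  fixes \<Theta> :: "(real ^ 'm) set"
    and C :: "real ^ 'm \<Rightarrow> real ^ 'd \<Rightarrow> real"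
    and X :: "nat \<Rightarrow> real ^ 'd"
    and n :: nat
  assumes "CARD('d) \<ge> 2"
    and "open \<Theta>"
    and "copula_model \<Theta> C"
    and "power_bounded \<Theta> C"
    and "n \<ge> 1"
  shows "\<forall>\<theta> \<in> \<Theta>.
    (\<forall>\<alpha>. 0 < \<alpha> \<and> \<alpha> < 1 \<longrightarrow>
       bounded ((\<lambda>u. S_alpha C n X \<alpha> u \<theta>) ` positive_region (C \<theta>))) \<and>
    (\<forall>\<beta>. 0 < \<beta> \<longrightarrow>
       bounded ((\<lambda>u. S_beta C n X \<beta> u \<theta>) ` positive_region (C \<theta>))) \<and>
    (\<forall>\<gamma>. 0 < \<gamma> \<and> w_denom C n X \<gamma> \<theta> \<noteq> 0 \<longrightarrow>
       bounded ((\<lambda>u. S_gamma C n X \<gamma> u \<theta>) ` positive_region (C \<theta>)))"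
proof (intro ballI conjI allI impI)
  fix \<theta> assume \<theta>: "\<theta> \<in> \<Theta>"
  note bnd = power_bounded_imp_bounded[OF \<open>power_bounded \<Theta> C\<close> \<theta>]
  have C: "0 \<le> C \<theta> u" "C \<theta> u \<le> 1" if "u \<in> positive_region (C \<theta>)" for u
    using that copula_le_1[of "C \<theta>" u] \<open>copula_model \<Theta> C\<close> \<theta>
    by (auto simp: copula_model_def positive_region_def)
  note E = empirical_copula_nonneg[of n X] empirical_copula_le_1[of n X]
  {
    fix \<alpha> :: real assume \<alpha>: "0 < \<alpha> \<and> \<alpha> < 1"
    \<comment> \<open>The factors of \<open>S_alpha\<close> are regrouped: the constant 1 / (1 -
      \<alpha>) joins the weight, leaving the power with exponent \<alpha> in front.\<close>
    have "bounded ((\<lambda>u. (C \<theta> u powr \<alpha> * (1 / (1 - \<alpha>) *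
        (C \<theta> u powr (1 - \<alpha>) - empirical_copula n X u powr (1 - \<alpha>)))) *\<^sub>R score C u \<theta>)
        ` positive_region (C \<theta>))"
    proof (rule bnd)
      fix u assume u: "u \<in> positive_region (C \<theta>)"
      \<comment> \<open>Since \<alpha> < 1, the exponent is positive and the power maps [0,1] into
        itself, even where the empirical copula vanishes.\<close>
      have "C \<theta> u powr (1 - \<alpha>) \<le> 1" "empirical_copula n X u powr (1 - \<alpha>) \<le> 1"
        using C[OF u] E[of u] \<alpha> by (auto intro: powr_le1)
      then have "\<bar>C \<theta> u powr (1 - \<alpha>) - empirical_copula n X u powr (1 - \<alpha>)\<bar> \<le> 1"
        using powr_ge_zero[of "C \<theta> u" "1 - \<alpha>"]
          powr_ge_zero[of "empirical_copula n X u" "1 - \<alpha>"] by linarith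
      then show "\<bar>1 / (1 - \<alpha>) * (C \<theta> u powr (1 - \<alpha>) - empirical_copula n X u powr (1 - \<alpha>))\<bar>
          \<le> 1 / (1 - \<alpha>)"
        using \<alpha> by (simp add: abs_mult divide_right_mono)
    qed (use \<alpha> in simp)
    then show "bounded ((\<lambda>u. S_alpha C n X \<alpha> u \<theta>) ` positive_region (C \<theta>))"
      by (simp add: S_alpha_def mult_ac)
  next
    fix \<beta> :: real assume "0 < \<beta>"
    then show "bounded ((\<lambda>u. S_beta C n X \<beta> u \<theta>) ` positive_region (C \<theta>))"
      unfolding S_beta_def
    proof (rule bnd)
      fix u assume u: "u \<in> positive_region (C \<theta>)"
      show "\<bar>C \<theta> u - empirical_copula n X u\<bar> \<le> 1"
        using C[OF u] E[of u] by linarith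
    qed
  next
    fix \<gamma> :: real assume "0 < \<gamma> \<and> w_denom C n X \<gamma> \<theta> \<noteq> 0"
    then have "0 < \<gamma>" ..
    then show "bounded ((\<lambda>u. S_gamma C n X \<gamma> u \<theta>) ` positive_region (C \<theta>))"
      unfolding S_gamma_def
    proof (rule bnd)
      fix u assume u: "u \<in> positive_region (C \<theta>)"
      \<comment> \<open>No estimate of \<open>w_hat\<close> is made: for fixed sample, \<gamma> and
        \<theta> it is one real number, so its absolute value may enter the bound.\<close>
      have "\<bar>w_hat C n X \<gamma> \<theta> * C \<theta> u\<bar> \<le> \<bar>w_hat C n X \<gamma> \<theta>\<bar>"
        using C[OF u] by (simp add: abs_mult mult_left_le)
      then show "\<bar>w_hat C n X \<gamma> \<theta> * C \<theta> u - empirical_copula n X u\<bar> \<le> \<bar>w_hat C n X \<gamma> \<theta>\<bar> + 1"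
        using E[of u] by linarith
    qed
  }
qed

end
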